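(* Let $\mathbb{K}$ be either $\mathbb{R}$ or a finite field $\mathbb{F}_q$ with $q$ odd; in the latter case let $\mathbf{e}$ be a non-square of $\mathbb{F}_q$. Every non-degenerate universal conformal geometry of dimension $2$ over $\mathbb{K}$ is isomorphic to one whose quadratic form $Q$ is isometric to $[+1,+1,+1,-1,-1]$. For geometries with $Q$ so normalized, the pair of norms $(Q(L),Q(P))$, taken up to squares, uniquely determines the geometry up to isomorphism; each of $Q(L),Q(P)$ may be $0$, $+1$ or $-1$ if $\mathbb{K}=\mathbb{R}$, and $0$, $1$ or $\mathbf{e}$ if $\mathbb{K}=\mathbb{F}_q$, and all $3\times3$ pairs occur, giving exactly $9$ non-degenerate geometries of dimension $2$ up to isomorphism.
   Context: For a quadratic form $Q$, $B(u,v)=Q(u+v)-Q(u)-Q(v)$; $[a_1,\dots,a_m]$ denotes $\sum a_i x_i^2$. A universal conformal geometry of dimension $n$ is a tuple $(V,Q,P,L)$ where $V$ is a vector space of dimension $n+3$ over $\mathbb{K}$, $Q$ is a quadratic form with non-degenerate associated bilinear form $B$, and $P,L\in\mathbb{P}V$ are orthogonal. Two geometries $(V,Q,P,L)$ and $(V',Q',P',L')$ are isomorphic if there are a linear isomorphism $f:V\to V'$ and $\lambda\in\mathbb{K}^\times$ with $Q'\circ f=\lambda Q$, $f(P)=P'$, $f(L)=L'$. The norm of a point $[v]\in\mathbb{P}V$ is the class of $Q(v)$ in $\mathbb{K}^\times/(\mathbb{K}^\times)^2\cup\{0\}$. A hypercycle is a $c\in\mathbb{P}V$ with $Q(c)=0$;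 it is a point if $B(P,c)=0$, a hyperplane if $B(L,c)=0$, and ideal if both. The geometry is non-degenerate if there are a non-ideal point $p$ and a non-ideal hyperplane $l$ with $B(p,l)=0$. *)

theory Defs
  imports "HOL-Analysis.Analysis"
begin

section \<open>Quadratic forms\<close>

definition polar :: "('v::ab_group_add \<Rightarrow> 'k::field) \<Rightarrow> 'v \<Rightarrow> 'v \<Rightarrow> 'k" where
  "polar Q u v = Q (u + v) - Q u - Q v"

definition quadratic_form ::
    "('k::field \<Rightarrow> 'v::ab_group_add \<Rightarrow> 'v) \<Rightarrow> ('v \<Rightarrow> 'k) \<Rightarrow> bool" where
  "quadratic_form smul Q \<longleftrightarrow>
     (\<forall>a v. Q (smul a v) = a ^ 2 * Q v) \<and>
     (\<forall>u. Vector_Spaces.linear smul (*) (\<lambda>v. polar Q u v)) \<and>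
     (\<forall>v. Vector_Spaces.linear smul (*) (\<lambda>u. polar Q u v))"

definition nondegenerate_form :: "('v::ab_group_add \<Rightarrow> 'k::field) \<Rightarrow> bool" where
  "nondegenerate_form Q \<longleftrightarrow> (\<forall>u. (\<forall>v. polar Q u v = 0) \<longrightarrow> u = 0)"

definition isometric_forms ::
    "('k::field \<Rightarrow> 'v::ab_group_add \<Rightarrow> 'v) \<Rightarrow> ('v \<Rightarrow> 'k) \<Rightarrow>
     ('k \<Rightarrow> 'w::ab_group_add \<Rightarrow> 'w) \<Rightarrow> ('w \<Rightarrow> 'k) \<Rightarrow> bool" where
  "isometric_forms smul Q smul' Q' \<longleftrightarrow>
     (\<exists>f. Vector_Spaces.linear smul smul' f \<and> bij f \<and> (\<forall>v. Q' (f v) = Q v))"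

definition diagonal_form :: "'k::field ^ 'n \<Rightarrow> 'k ^ 'n \<Rightarrow> 'k" where
  "diagonal_form a x = (\<Sum>i\<in>UNIV. a $ i * (x $ i) ^ 2)"

lemma UNIV_5: "(UNIV :: 5 set) = {1, 2, 3, 4, 5}"
proof -
  have "card {1, 2, 3, 4, 5 :: 5} = CARD(5)"
    by simp
  then show ?thesis
    by (metis card_subset_eq finite subset_UNIV)
qed

lemma diagonal_form_5:
  "diagonal_form (vector [a, b, c, d, e] :: 'k::field ^ 5) x =
     a * (x $ 1) ^ 2 + b * (x $ 2) ^ 2 + c * (x $ 3) ^ 2 + d * (x $ 4) ^ 2 + e * (x $ 5) ^ 2"
  unfolding diagonal_form_def UNIV_5 vector_def by simp


section \<open>Projective points and their norms\<close>

text \<open>A projective point is represented by the corresponding one-dimensional subspace.\<close>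

definition proj_points :: "('k::field \<Rightarrow> 'v::ab_group_add \<Rightarrow> 'v) \<Rightarrow> 'v set set" where
  "proj_points smul = {module.span smul {v} | v. v \<noteq> 0}"

definition proj_orthogonal :: "('v::ab_group_add \<Rightarrow> 'k::field) \<Rightarrow> 'v set \<Rightarrow> 'v set \<Rightarrow> bool" where
  "proj_orthogonal Q p q \<longleftrightarrow> (\<forall>u\<in>p. \<forall>v\<in>q. polar Q u v = 0)"

text \<open>The class of an element modulo non-zero squares; the class of \<open>0\<close> is \<open>{0}\<close>.\<close>

definition square_class :: "'k::field \<Rightarrow> 'k set" where
  "square_class a = {a * c ^ 2 | c. c \<noteq> 0}"

definition proj_norm :: "('v::ab_group_add \<Rightarrow> 'k::field) \<Rightarrow> 'v set \<Rightarrow> 'k set" where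
  "proj_norm Q p = the_elem ((\<lambda>v. square_class (Q v)) ` (p - {0}))"

lemma square_class_mult_square:
  assumes "c \<noteq> (0::'k::field)"
  shows "square_class (c ^ 2 * a) = square_class a"
proof (intro equalityI subsetI)
  fix x assume "x \<in> square_class (c ^ 2 * a)"
  then obtain d where d: "d \<noteq> 0" "x = a * (c * d) ^ 2"
    by (auto simp: square_class_def power_mult_distrib mult_ac)
  then have "c * d \<noteq> 0"
    using assms by simp
  with d(2) show "x \<in> square_class a"
    unfolding square_class_def by blast
next
  fix x assume "x \<in> square_class a"
  then obtain d where d: "d \<noteq> 0" "x = a * d ^ 2"
    by (auto simp: square_class_def)
  then have "x = c ^ 2 * a * (d / c) ^ 2" "d / c \<noteq> 0"
    using assms by (auto simp: power_divide)
  then show "x \<in> square_class (c ^ 2 * a)"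
    unfolding square_class_def by blast
qed

lemma proj_norm_span:
  assumes "vector_space smul" and "quadratic_form smul Q" and "v \<noteq> 0"
  shows "proj_norm Q (module.span smul {v}) = square_class (Q v)"
proof -
  interpret vector_space smul by fact
  have "square_class (Q u) = square_class (Q v)" if "u \<in> span {v} - {0}" for u
  proof -
    from that obtain k where k: "u = smul k v" "k \<noteq> 0"
      by (auto simp: span_singleton)
    with assms(2) show ?thesis
      by (simp add: quadratic_form_def square_class_mult_square)
  qed
  moreover have "v \<in> span {v} - {0}"
    using assms(3) by (simp add: span_base)
  ultimately have "(\<lambda>u. square_class (Q u)) ` (span {v} - {0}) = {square_class (Q v)}"
    by blast
  then show ?thesis
    by (simp add: proj_norm_def)
qed


section \<open>Universal conformal geometries\<close>

text \<open>The vector space \<open>V\<close> is a type \<open>'v\<close> together with a scalar multiplication.\<close>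

record ('k, 'v) ucg =
  ucg_scale :: "'k \<Rightarrow> 'v \<Rightarrow> 'v"
  ucg_form :: "'v \<Rightarrow> 'k"
  ucg_P :: "'v set"
  ucg_L :: "'v set"

text \<open>The library's \<open>dim\<close> is \<open>0\<close> on infinite-dimensional spaces, so the equation
  \<open>dim UNIV = n + 3\<close> includes finite-dimensionality.\<close>

definition universal_conformal_geometry ::
    "nat \<Rightarrow> ('k::field, 'v::ab_group_add) ucg \<Rightarrow> bool" where
  "universal_conformal_geometry n G \<longleftrightarrow>
     vector_space (ucg_scale G) \<and>
     vector_space.dim (ucg_scale G) UNIV = n + 3 \<and>
     quadratic_form (ucg_scale G) (ucg_form G) \<and>
     nondegenerate_form (ucg_form G) \<and>
     ucg_P G \<in> proj_points (ucg_scale G) \<and>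
     ucg_L G \<in> proj_points (ucg_scale G) \<and>
     proj_orthogonal (ucg_form G) (ucg_P G) (ucg_L G)"

definition ucg_hypercycle :: "('k::field, 'v::ab_group_add) ucg \<Rightarrow> 'v set \<Rightarrow> bool" where
  "ucg_hypercycle G c \<longleftrightarrow> c \<in> proj_points (ucg_scale G) \<and> (\<forall>v\<in>c. ucg_form G v = 0)"

definition ucg_point :: "('k::field, 'v::ab_group_add) ucg \<Rightarrow> 'v set \<Rightarrow> bool" where
  "ucg_point G c \<longleftrightarrow> ucg_hypercycle G c \<and> proj_orthogonal (ucg_form G) (ucg_P G) c"

definition ucg_hyperplane :: "('k::field, 'v::ab_group_add) ucg \<Rightarrow> 'v set \<Rightarrow> bool" where
  "ucg_hyperplane G c \<longleftrightarrow> ucg_hypercycle G c \<and> proj_orthogonal (ucg_form G) (ucg_L G) c"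

definition ucg_ideal :: "('k::field, 'v::ab_group_add) ucg \<Rightarrow> 'v set \<Rightarrow> bool" where
  "ucg_ideal G c \<longleftrightarrow> ucg_point G c \<and> ucg_hyperplane G c"

definition nondegenerate_ucg :: "nat \<Rightarrow> ('k::field, 'v::ab_group_add) ucg \<Rightarrow> bool" where
  "nondegenerate_ucg n G \<longleftrightarrow>
     universal_conformal_geometry n G \<and>
     (\<exists>p l. ucg_point G p \<and> \<not> ucg_ideal G p \<and>
            ucg_hyperplane G l \<and> \<not> ucg_ideal G l \<and>
            proj_orthogonal (ucg_form G) p l)"

definition ucg_isomorphic ::
    "('k::field, 'v::ab_group_add) ucg \<Rightarrow> ('k, 'w::ab_group_add) ucg \<Rightarrow> bool" where
  "ucg_isomorphic G G' \<longleftrightarrow>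
     (\<exists>f c. Vector_Spaces.linear (ucg_scale G) (ucg_scale G') f \<and> bij f \<and> c \<noteq> 0 \<and>
            (\<forall>v. ucg_form G' (f v) = c * ucg_form G v) \<and>
            f ` ucg_P G = ucg_P G' \<and> f ` ucg_L G = ucg_L G')"

definition ucg_normalized :: "('k::field, 'v::ab_group_add) ucg \<Rightarrow> bool" where
  "ucg_normalized G \<longleftrightarrow>
     isometric_forms (ucg_scale G) (ucg_form G)
       (*s) (diagonal_form (vector [1, 1, 1, -1, -1] :: 'k ^ 5))"

definition norm_pair :: "('k::field, 'v::ab_group_add) ucg \<Rightarrow> 'k set \<times> 'k set" where
  "norm_pair G = (proj_norm (ucg_form G) (ucg_L G), proj_norm (ucg_form G) (ucg_P G))"

definition ucg_iso_rel ::
    "('k::field, 'v::ab_group_add) ucg set \<Rightarrow> (('k, 'v) ucg \<times> ('k, 'v) ucg) set" where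
  "ucg_iso_rel A = {(G, G'). G \<in> A \<and> G' \<in> A \<and> ucg_isomorphic G G'}"

lemma ucg_isomorphic_refl:
  assumes "vector_space (ucg_scale G)"
  shows "ucg_isomorphic G G"
proof -
  interpret vector_space "ucg_scale G" by fact
  show ?thesis
    unfolding ucg_isomorphic_def using linear_id by (intro exI[of _ id] exI[of _ 1]) auto
qed

lemma ucg_isomorphic_sym:
  assumes "ucg_isomorphic G G'"
  shows "ucg_isomorphic G' G"
proof -
  obtain f c where f: "Vector_Spaces.linear (ucg_scale G) (ucg_scale G') f" "bij f" "c \<noteq> 0"
      "\<And>v. ucg_form G' (f v) = c * ucg_form G v"
      "f ` ucg_P G = ucg_P G'" "f ` ucg_L G = ucg_L G'"
    using assms unfolding ucg_isomorphic_def by blast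
  interpret Vector_Spaces.linear "ucg_scale G" "ucg_scale G'" f by fact
  have f_inv: "f (inv f w) = w" and inv_f: "inv f (f v) = v" for v w
    using f(2) by (auto simp: bij_def surj_f_inv_f)
  have "Vector_Spaces.linear (ucg_scale G') (ucg_scale G) (inv f)"
  proof (unfold_locales, goal_cases)
    case (1 x y)
    show ?case by (metis add f_inv inv_f)
  next
    case (2 r x)
    show ?case by (metis scale f_inv inv_f)
  qed
  moreover have "ucg_form G (inv f w) = inverse c * ucg_form G' w" for w
    using f(3) f(4)[of "inv f w"] by (simp add: f_inv)
  moreover have "inv f ` ucg_P G' = ucg_P G" "inv f ` ucg_L G' = ucg_L G"
    by (simp_all only: f(5,6)[symmetric] image_image inv_f image_ident)
  ultimately show ?thesis
    unfolding ucg_isomorphic_def using f(2,3) bij_imp_bij_inv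
    by (intro exI[of _ "inv f"] exI[of _ "inverse c"]) auto
qed

lemma ucg_isomorphic_trans:
  assumes "ucg_isomorphic G G'" and "ucg_isomorphic G' G''"
  shows "ucg_isomorphic G G''"
proof -
  obtain f c where f: "Vector_Spaces.linear (ucg_scale G) (ucg_scale G') f" "bij f" "c \<noteq> 0"
      "\<And>v. ucg_form G' (f v) = c * ucg_form G v"
      "f ` ucg_P G = ucg_P G'" "f ` ucg_L G = ucg_L G'"
    using assms(1) unfolding ucg_isomorphic_def by blast
  obtain g d where g: "Vector_Spaces.linear (ucg_scale G') (ucg_scale G'') g" "bij g" "d \<noteq> 0"
      "\<And>v. ucg_form G'' (g v) = d * ucg_form G' v"
      "g ` ucg_P G' = ucg_P G''" "g ` ucg_L G' = ucg_L G''"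
    using assms(2) unfolding ucg_isomorphic_def by blast
  have "Vector_Spaces.linear (ucg_scale G) (ucg_scale G'') (g \<circ> f)"
    using f(1) g(1) by (rule Vector_Spaces.linear_compose)
  moreover have "(g \<circ> f) ` ucg_P G = ucg_P G''" "(g \<circ> f) ` ucg_L G = ucg_L G''"
    by (simp_all only: image_comp[symmetric] f(5,6) g(5,6))
  ultimately show ?thesis
    unfolding ucg_isomorphic_def using f(2-4) g(2-4)
    by (intro exI[of _ "g \<circ> f"] exI[of _ "d * c"]) (auto simp: bij_comp mult.assoc)
qed

lemma equiv_ucg_iso_rel:
  assumes "\<And>G. G \<in> A \<Longrightarrow> vector_space (ucg_scale G)"
  shows "equiv A (ucg_iso_rel A)"
proof (rule equivI)
  show "ucg_iso_rel A \<subseteq> A \<times> A"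
    by (auto simp: ucg_iso_rel_def)
  show "refl_on A (ucg_iso_rel A)"
    using assms by (auto simp: refl_on_def ucg_iso_rel_def ucg_isomorphic_refl)
  show "sym (ucg_iso_rel A)"
    by (auto simp: sym_def ucg_iso_rel_def ucg_isomorphic_sym)
  show "trans (ucg_iso_rel A)"
    unfolding trans_def ucg_iso_rel_def using ucg_isomorphic_trans by blast
qed


section \<open>Field isomorphisms\<close>

definition field_iso :: "('a::field \<Rightarrow> 'b::field) \<Rightarrow> bool" where
  "field_iso \<phi> \<longleftrightarrow> bij \<phi> \<and> \<phi> 1 = 1 \<and>
     (\<forall>x y. \<phi> (x + y) = \<phi> x + \<phi> y) \<and> (\<forall>x y. \<phi> (x * y) = \<phi> x * \<phi> y)"

end

theory Submission
  imports Defs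
begin

text \<open>Let \<open>p\<close> and \<open>l\<close> be the point and hyperplane that witness non-degeneracy. Then
  \<open>\<langle>P, l\<rangle>\<close> and \<open>\<langle>L, p\<rangle>\<close> are orthogonal hyperbolic planes, whatever the norms of \<open>P\<close> and \<open>L\<close> are,
  so that \<open>V\<close> is their orthogonal sum with an anisotropic line \<open>\<langle>w\<rangle>\<close>. Dividing \<open>Q\<close> by \<open>Q(w)\<close> yields
  a model that depends only on the values of \<open>Q/Q(w)\<close> at \<open>P\<close> and \<open>L\<close>. The dimension being odd, a
  similitude between isometric forms has a square as its ratio, by comparing determinants; hence
  the norms of \<open>P\<close> and \<open>L\<close> are invariants once the form is normalized.\<close>

section \<open>Linear isomorphisms and isometries\<close>

lemma linear_bij_inv:
  assumes "Vector_Spaces.linear s1 s2 f" and "bij f"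
  shows "Vector_Spaces.linear s2 s1 (inv f)"
proof -
  interpret Vector_Spaces.linear s1 s2 f by fact
  interpret vector_space_pair s1 s2 ..
  obtain g where g: "Vector_Spaces.linear s2 s1 g" "g \<circ> f = id"
    using linear_injective_left_inverse[OF assms(1)] assms(2) unfolding bij_def by blast
  have "g = inv f"
    using g(2) assms(2) by (metis bij_def comp_assoc comp_id id_comp surj_iff)
  with g(1) show ?thesis by simp
qed

text \<open>A linear map sends the span of a vector to the span of its image, so it is enough to
  follow one representative each of \<open>P\<close> and \<open>L\<close>.\<close>

lemma ucg_isomorphicI:
  assumes "Vector_Spaces.linear (ucg_scale G) (ucg_scale G') f" and "bij f" and "c \<noteq> 0"
    and "\<And>v. ucg_form G' (f v) = c * ucg_form G v"
    and "ucg_P G = module.span (ucg_scale G) {u}" "ucg_P G' = module.span (ucg_scale G') {f u}"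
    and "ucg_L G = module.span (ucg_scale G) {v}" "ucg_L G' = module.span (ucg_scale G') {f v}"
  shows "ucg_isomorphic G G'"
proof -
  interpret Vector_Spaces.linear "ucg_scale G" "ucg_scale G'" f by fact
  have "f ` ucg_P G = ucg_P G'" "f ` ucg_L G = ucg_L G'"
    using span_image[of "{u}"] span_image[of "{v}"] assms(5-8) by auto
  then show ?thesis
    unfolding ucg_isomorphic_def using assms(1-4) by blast
qed

lemma polar_image:
  assumes "Vector_Spaces.linear s1 s2 f" and "\<And>v. Q' (f v) = c * Q v"
  shows "polar Q' (f u) (f v) = c * polar Q u v"
proof -
  interpret Vector_Spaces.linear s1 s2 f by fact
  show ?thesis
    by (simp add: polar_def assms(2) add[symmetric] algebra_simps)
qed

lemma quadratic_form_polar: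
  assumes "quadratic_form s Q"
  shows "polar Q (u + v) w = polar Q u w + polar Q v w"
    and "polar Q (s a u) w = a * polar Q u w"
    and "polar Q w (u + v) = polar Q w u + polar Q w v"
    and "polar Q w (s a u) = a * polar Q w u"
    and "polar Q u v = polar Q v u"
    and "Q (s a u) = a\<^sup>2 * Q u"
    and "Q (u + v) = Q u + Q v + polar Q u v"
    and "polar Q u u = 2 * Q u"
proof -
  have 1: "polar Q (u + v) w = polar Q u w + polar Q v w" "polar Q (s a u) w = a * polar Q u w"
    for a u v w
    using assms unfolding quadratic_form_def Vector_Spaces.linear_iff by auto
  then show "polar Q (u + v) w = polar Q u w + polar Q v w" "polar Q (s a u) w = a * polar Q u w"
    by auto
  have 2: "polar Q u v = polar Q v u" for u v by (simp add: polar_def add.commute)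
  show "polar Q w (u + v) = polar Q w u + polar Q w v" "polar Q w (s a u) = a * polar Q w u"
    using 1 2 by metis+
  show "polar Q u v = polar Q v u" by fact
  have 3: "Q (s a u) = a\<^sup>2 * Q u" for a u
    using assms by (auto simp: quadratic_form_def)
  then show "Q (s a u) = a\<^sup>2 * Q u" .
  show 4: "Q (u + v) = Q u + Q v + polar Q u v" by (simp add: polar_def)
  have "vector_space s"
    using assms by (auto simp: quadratic_form_def Vector_Spaces.linear_iff)
  then interpret vector_space s .
  have "u + u = s 2 u"
    using scale_left_distrib[of 1 1 u] by simp
  then show "polar Q u u = 2 * Q u"
    using 3[of 2 u] by (simp add: polar_def power2_eq_square algebra_simps)
qed

section \<open>Ratios of similitudes and the invariance of the norms\<close>

lemma polar_diagonal_form: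
  "polar (diagonal_form a) x y = 2 * (\<Sum>i\<in>UNIV. a $ i * x $ i * y $ i)"
  unfolding polar_def diagonal_form_def sum_subtractf[symmetric] sum_distrib_left
  by (rule sum.cong) (auto simp: power2_eq_square algebra_simps)

text \<open>With \<open>M = matrix f\<close> and \<open>D a\<close> the diagonal matrix of
  \<open>a\<close>, polarizing the hypothesis gives
  \<open>transpose M ** D a ** M = c * D b\<close>, and determinants are taken on both sides.
  Polarization doubles both sides; \<open>2 \<noteq> 0\<close> cancels this factor.\<close>

lemma diagonal_form_similitude_det:
  fixes f :: "'k::field ^ 'n \<Rightarrow> 'k ^ 'n"
  assumes "(2::'k) \<noteq> 0" and f: "Vector_Spaces.linear (*s) (*s) f"
    and Q: "\<And>x. diagonal_form a (f x) = c * diagonal_form b x"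
  shows "(\<Prod>i\<in>UNIV. a $ i) * (det (matrix f))\<^sup>2 = c ^ CARD('n) * (\<Prod>i\<in>UNIV. b $ i)"
proof -
  let ?D = "\<lambda>a. (\<chi> i j. if i = j then a $ i else 0) :: 'k ^ 'n ^ 'n"
  have D: "det (?D a) = (\<Prod>i\<in>UNIV. a $ i)" for a
    by (subst det_diagonal) auto
  have "(transpose (matrix f) ** (?D a ** matrix f)) $ i $ j = (c * (?D b $ i $ j))" for i j
  proof -
    have "2 * (\<Sum>k\<in>UNIV. a $ k * f (axis i 1) $ k * f (axis j 1) $ k) =
          c * (2 * (\<Sum>k\<in>UNIV. b $ k * axis i 1 $ k * axis j 1 $ k))"
      using polar_image[where Q = "diagonal_form b" and Q' = "diagonal_form a", OF f Q] by (simp only: polar_diagonal_form)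
    moreover have "(\<Sum>k\<in>UNIV. b $ k * axis i 1 $ k * axis j 1 $ k) = ?D b $ i $ j"
    proof -
      have "b $ k * axis i 1 $ k * axis j 1 $ k = (if k = i then ?D b $ i $ j else 0)" for k
        by (simp add: axis_def)
      then show ?thesis
        by simp
    qed
    ultimately have "(\<Sum>k\<in>UNIV. a $ k * f (axis i 1) $ k * f (axis j 1) $ k) = c * ?D b $ i $ j"
      by (simp only: mult.left_commute[of c] mult_left_cancel[OF assms(1)])
    moreover have "(?D a ** matrix f) $ k $ j = a $ k * f (axis j 1) $ k" for k j
    proof -
      have "?D a $ k $ l * matrix f $ l $ j = (if l = k then a $ k * f (axis j 1) $ k else 0)" for l
        by (simp add: matrix_def)
      then show ?thesis
        by (simp add: matrix_matrix_mult_def)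
    qed
    ultimately show ?thesis
      by (subst matrix_matrix_mult_def) (simp add: transpose_def matrix_def mult_ac)
  qed
  then have "transpose (matrix f) ** (?D a ** matrix f) = ?D (\<chi> i. c * b $ i)"
    by (simp add: vec_eq_iff)
  then have "det (transpose (matrix f) ** (?D a ** matrix f)) = (\<Prod>i\<in>UNIV. c * b $ i)"
    using D[of "\<chi> i. c * b $ i"] by simp
  then show ?thesis
    by (simp add: det_mul D prod.distrib power2_eq_square mult_ac)
qed

text \<open>The diagonal entries multiply to 1, so the determinant identity reads
  \<open>det\<^sup>2 = c ^ 5\<close>. The exponent is odd: dividing by the square
  \<open>c ^ 4\<close> leaves \<open>c\<close> itself as a square.\<close>

lemma similitude_factor_square:
  assumes "(2::'k::field) \<noteq> 0"
    and f: "Vector_Spaces.linear (*s) (*s) (f :: 'k ^ 5 \<Rightarrow> 'k ^ 5)" and c: "c \<noteq> 0"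
    and Q: "\<And>x. diagonal_form (vector [1, 1, 1, -1, -1]) (f x) =
                 c * diagonal_form (vector [1, 1, 1, -1, -1]) x"
  shows "\<exists>r. r \<noteq> 0 \<and> c = r\<^sup>2"
proof -
  have "(\<Prod>i\<in>(UNIV::5 set). (vector [1, 1, 1, -1, -1] :: 'k ^ 5) $ i) = 1"
    unfolding UNIV_5 vector_def by simp
  then have "(det (matrix f))\<^sup>2 = c ^ 5"
    using diagonal_form_similitude_det[OF assms(1) f Q] by simp
  then have "c = (det (matrix f) / c\<^sup>2)\<^sup>2"
    using c by (simp add: power_divide power_mult[symmetric] nonzero_eq_divide_eq flip: power_Suc)
  with c show ?thesis
    by (intro exI[of _ "det (matrix f) / c\<^sup>2"]) (auto simp: power2_eq_square)
qed

lemma square_class_eqD: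
  assumes "square_class a = square_class b"
  shows "\<exists>c. c \<noteq> 0 \<and> a = b * c\<^sup>2"
proof -
  have "a \<in> square_class a"
    unfolding square_class_def by (auto intro!: exI[of _ 1])
  then show ?thesis
    using assms unfolding square_class_def by auto
qed

text \<open>Conjugating the isomorphism by the two normalizing isometries yields a similitude of the
  standard form to itself with the same ratio \<open>c\<close>. Hence \<open>c\<close> is a non-zero
  square, and multiplying by it does not change a square class.\<close>

lemma norm_pair_eq_if_isomorphic:
  fixes G :: "('k::field, 'v::ab_group_add) ucg" and G' :: "('k, 'w::ab_group_add) ucg"
  assumes two: "(2::'k) \<noteq> 0" and G: "universal_conformal_geometry n G" "ucg_normalized G"
    and G': "universal_conformal_geometry n G'" "ucg_normalized G'" and iso: "ucg_isomorphic G G'"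
  shows "norm_pair G = norm_pair G'"
proof -
  let ?N = "diagonal_form (vector [1, 1, 1, -1, -1] :: 'k ^ 5)"
  obtain f c where f: "Vector_Spaces.linear (ucg_scale G) (ucg_scale G') f" "bij f" "c \<noteq> 0"
      "\<And>v. ucg_form G' (f v) = c * ucg_form G v"
      "f ` ucg_P G = ucg_P G'" "f ` ucg_L G = ucg_L G'"
    using iso unfolding ucg_isomorphic_def by blast
  obtain g where g: "Vector_Spaces.linear (ucg_scale G) (*s) g" "bij g"
      "\<And>v. ?N (g v) = ucg_form G v"
    using G(2) unfolding ucg_normalized_def isometric_forms_def by blast
  obtain h where h: "Vector_Spaces.linear (ucg_scale G') (*s) h" "bij h"
      "\<And>v. ?N (h v) = ucg_form G' v"
    using G'(2) unfolding ucg_normalized_def isometric_forms_def by blast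
  have "Vector_Spaces.linear (*s) (*s) (h \<circ> f \<circ> inv g)"
    by (intro Vector_Spaces.linear_compose[OF linear_bij_inv[OF g(1,2)]]
        Vector_Spaces.linear_compose[OF f(1) h(1)])
  moreover have "?N ((h \<circ> f \<circ> inv g) x) = c * ?N x" for x
    using g(3)[of "inv g x"] g(2) by (simp add: h(3) f(4) bij_def surj_f_inv_f)
  ultimately obtain r where r: "r \<noteq> 0" "c = r\<^sup>2"
    using similitude_factor_square[OF two _ f(3)] by blast
  interpret Vector_Spaces.linear "ucg_scale G" "ucg_scale G'" f by fact
  have "proj_norm (ucg_form G) p = proj_norm (ucg_form G') (f ` p)"
    if p: "p \<in> proj_points (ucg_scale G)" for p
  proof -
    obtain v where v: "v \<noteq> 0" "p = vs1.span {v}"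
      using p by (auto simp: proj_points_def)
    have "f v \<noteq> 0"
      using v(1) f(2) by (metis bij_def injD zero)
    moreover have "f ` p = vs2.span {f v}"
      using span_image[of "{v}"] v(2) by simp
    moreover have "square_class (ucg_form G' (f v)) = square_class (ucg_form G v)"
      using r by (simp add: f(4) square_class_mult_square)
    ultimately show ?thesis
      using G(1) G'(1) v
      by (simp add: universal_conformal_geometry_def proj_norm_span)
  qed
  then show ?thesis
    using G(1) by (simp add: norm_pair_def universal_conformal_geometry_def f(5,6))
qed

section \<open>The model geometries\<close>

text \<open>The coordinates run along P, l, L, p, w, with l and p scaled so that B(P,l) = B(L,p) = 1
  once the form has been divided by Q(w). The parameters \<open>s\<close> and \<open>t\<close> are
  the remaining values at P and L.\<close>

definition model_form :: "'k::field \<Rightarrow> 'k \<Rightarrow> 'k ^ 5 \<Rightarrow> 'k" where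
  "model_form s t x = s * (x $ 1)\<^sup>2 + x $ 1 * x $ 2 + t * (x $ 3)\<^sup>2 + x $ 3 * x $ 4 + (x $ 5)\<^sup>2"

definition model_ucg :: "'k::field \<Rightarrow> 'k \<Rightarrow> ('k, 'k ^ 5) ucg" where
  "model_ucg s t = \<lparr>ucg_scale = (*s), ucg_form = model_form s t,
     ucg_P = vec.span {axis 1 1}, ucg_L = vec.span {axis 3 1}\<rparr>"

lemma vec5_eq_iff:
  "(x :: 'k ^ 5) = y \<longleftrightarrow> x $ 1 = y $ 1 \<and> x $ 2 = y $ 2 \<and> x $ 3 = y $ 3 \<and> x $ 4 = y $ 4 \<and> x $ 5 = y $ 5"
proof -
  have "x = y \<longleftrightarrow> (\<forall>i\<in>UNIV. x $ i = y $ i)"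
    by (simp add: vec_eq_iff)
  then show ?thesis
    unfolding UNIV_5 by simp
qed

lemma vector_5 [simp]:
  "(vector [a, b, c, d, e] :: 'k::zero ^ 5) $ 1 = a"
  "(vector [a, b, c, d, e] :: 'k::zero ^ 5) $ 2 = b"
  "(vector [a, b, c, d, e] :: 'k::zero ^ 5) $ 3 = c"
  "(vector [a, b, c, d, e] :: 'k::zero ^ 5) $ 4 = d"
  "(vector [a, b, c, d, e] :: 'k::zero ^ 5) $ 5 = e"
  unfolding vector_def by simp_all

lemma axis_5 [simp]:
  "axis 1 a = (vector [a, 0, 0, 0, 0] :: 'k::zero ^ 5)"
  "axis 2 a = (vector [0, a, 0, 0, 0] :: 'k::zero ^ 5)"
  "axis 3 a = (vector [0, 0, a, 0, 0] :: 'k::zero ^ 5)"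
  "axis 4 a = (vector [0, 0, 0, a, 0] :: 'k::zero ^ 5)"
  "axis 5 a = (vector [0, 0, 0, 0, a] :: 'k::zero ^ 5)"
  unfolding vec5_eq_iff vector_5 by (simp_all add: axis_def)

lemma polar_model_form:
  "polar (model_form s t) x y = 2 * s * x $ 1 * y $ 1 + x $ 1 * y $ 2 + x $ 2 * y $ 1 +
     2 * t * x $ 3 * y $ 3 + x $ 3 * y $ 4 + x $ 4 * y $ 3 + 2 * x $ 5 * y $ 5"
  by (simp add: polar_def model_form_def power2_eq_square algebra_simps)

lemma quadratic_form_model: "quadratic_form (*s) (model_form s t)"
  unfolding quadratic_form_def Vector_Spaces.linear_iff
  by (auto simp: polar_model_form model_form_def power2_eq_square algebra_simps
      vec.vector_space_axioms vector_space_over_itself.vector_space_axioms)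

lemma nondegenerate_model_form:
  assumes "(2::'k::field) \<noteq> 0"
  shows "nondegenerate_form (model_form s t :: 'k ^ 5 \<Rightarrow> 'k)"
  unfolding nondegenerate_form_def
proof (intro allI impI)
  fix u :: "'k ^ 5" assume u: "\<forall>v. polar (model_form s t) u v = 0"
  have "u $ 1 = 0" using u[rule_format, of "axis 2 1"] by (simp add: polar_model_form)
  moreover have "u $ 3 = 0" using u[rule_format, of "axis 4 1"] by (simp add: polar_model_form)
  moreover have "u $ 5 = 0" using u[rule_format, of "axis 5 1"] assms by (simp add: polar_model_form)
  \<comment> \<open>The pairings with \<open>axis 1 1\<close> and \<open>axis 3 1\<close> involve
    \<open>s\<close> and \<open>t\<close>; these terms are gone only after the first and third
    coordinates are known to vanish.\<close>
  moreover have "u $ 2 = 0" using calculation u[rule_format, of "axis 1 1"]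
    by (simp add: polar_model_form)
  moreover have "u $ 4 = 0" using calculation u[rule_format, of "axis 3 1"]
    by (simp add: polar_model_form)
  ultimately show "u = 0" by (simp add: vec5_eq_iff)
qed

lemma proj_orthogonal_span:
  assumes "quadratic_form s Q" and "polar Q u v = 0"
  shows "proj_orthogonal Q (module.span s {u}) (module.span s {v})"
proof -
  have "vector_space s"
    using assms by (auto simp: quadratic_form_def Vector_Spaces.linear_iff)
  then interpret vector_space s .
  show ?thesis
    using assms(2)
    by (auto simp: proj_orthogonal_def span_singleton quadratic_form_polar[OF assms(1)])
qed

lemma nondegenerate_model:
  assumes "(2::'k::field) \<noteq> 0"
  shows "nondegenerate_ucg 2 (model_ucg s t :: ('k, 'k ^ 5) ucg)"
proof -
  note orth = proj_orthogonal_span[OF quadratic_form_model[of s t]]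
  \<comment> \<open>The isotropic vector \<open>axis 4 1\<close> is orthogonal to P but pairs to 1
    with L, and \<open>axis 2 1\<close> is orthogonal to L but pairs to 1 with P. So neither is
    ideal, and they are orthogonal to each other.\<close>
  let ?p = "vec.span {axis 4 1 :: 'k ^ 5}" and ?l = "vec.span {axis 2 1 :: 'k ^ 5}"
  have pts: "vec.span {axis i 1 :: 'k ^ 5} \<in> proj_points (*s)" for i
    unfolding proj_points_def by (auto intro!: exI[of _ "axis i 1"])
  have ucg: "universal_conformal_geometry 2 (model_ucg s t)"
    unfolding universal_conformal_geometry_def model_ucg_def ucg.simps vec_dim_card
    using pts quadratic_form_model nondegenerate_model_form[OF assms]
    by (auto intro!: orth simp: polar_model_form vec.vector_space_axioms simp del: axis_5)
       (simp add: polar_model_form)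
  have "\<forall>v\<in>?p. model_form s t v = 0" "\<forall>v\<in>?l. model_form s t v = 0"
    by (auto simp: vec.span_singleton model_form_def)
  then have hyp: "ucg_hypercycle (model_ucg s t) ?p" "ucg_hypercycle (model_ucg s t) ?l"
    using pts by (auto simp: ucg_hypercycle_def model_ucg_def simp del: axis_5)
  have "proj_orthogonal (model_form s t) (vec.span {axis 1 1}) ?p"
       "proj_orthogonal (model_form s t) (vec.span {axis 3 1}) ?l"
       "proj_orthogonal (model_form s t) ?p ?l"
    by (auto intro!: orth simp: polar_model_form)
  moreover have "\<not> proj_orthogonal (model_form s t) (vec.span {axis 3 1}) ?p"
    "\<not> proj_orthogonal (model_form s t) (vec.span {axis 1 1}) ?l"
  proof -
    have "polar (model_form s t) (axis 3 1) (axis 4 1) = 1"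
      "polar (model_form s t) (axis 1 1) (axis 2 1) = 1"
      by (simp_all add: polar_model_form)
    then show "\<not> proj_orthogonal (model_form s t) (vec.span {axis 3 1}) ?p"
      "\<not> proj_orthogonal (model_form s t) (vec.span {axis 1 1}) ?l"
      unfolding proj_orthogonal_def by (metis singletonI vec.span_base zero_neq_one)+
  qed
  ultimately show ?thesis
    using ucg hyp unfolding nondegenerate_ucg_def ucg_ideal_def ucg_point_def ucg_hyperplane_def
    by (intro conjI exI[of _ ?p] exI[of _ ?l]) (auto simp: model_ucg_def simp del: axis_5)
qed

text \<open>Each plane contributes a product, \<open>x $ 1 * (s * x $ 1 + x $ 2)\<close> or its
  analogue with \<open>t\<close>, and a product of two linear forms is the difference of the squares
  of their half sum and half difference. Together with the square of the fifth coordinate this makes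
  three positive and two negative squares.\<close>

lemma normalized_model:
  assumes two: "(2::'k::field) \<noteq> 0"
  shows "ucg_normalized (model_ucg s t :: ('k, 'k ^ 5) ucg)"
proof -
  define h :: 'k where "h = 1 / 2"
  have h: "2 * h = 1" using two by (simp add: h_def)
  define f :: "'k ^ 5 \<Rightarrow> 'k ^ 5" where
    "f x = vector [h * (x $ 1 + (s * x $ 1 + x $ 2)), h * (x $ 3 + (t * x $ 3 + x $ 4)), x $ 5,
                   h * (x $ 1 - (s * x $ 1 + x $ 2)), h * (x $ 3 - (t * x $ 3 + x $ 4))]" for x
  define g :: "'k ^ 5 \<Rightarrow> 'k ^ 5" where
    "g y = vector [y $ 1 + y $ 4, y $ 1 - y $ 4 - s * (y $ 1 + y $ 4),
                   y $ 2 + y $ 5, y $ 2 - y $ 5 - t * (y $ 2 + y $ 5), y $ 3]" for y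
  have "Vector_Spaces.linear (*s) (*s) f"
    by (auto simp: Vector_Spaces.linear_iff vec.vector_space_axioms vec5_eq_iff f_def algebra_simps)
  moreover have "bij f"
  proof (rule o_bij)
    have "g (f x) = x" for x
      unfolding vec5_eq_iff f_def g_def vector_5 by (intro conjI refl) (insert h, algebra+)
    then show "g \<circ> f = id" by auto
    have "f (g x) = x" for x
      unfolding vec5_eq_iff f_def g_def vector_5 by (intro conjI refl) (insert h, algebra+)
    then show "f \<circ> g = id" by auto
  qed
  moreover have "diagonal_form (vector [1, 1, 1, -1, -1]) (f x) = model_form s t x" for x
    unfolding diagonal_form_5 model_form_def f_def vector_5 using h by algebra
  ultimately show ?thesis
    unfolding ucg_normalized_def isometric_forms_def model_ucg_def by auto
qed

text \<open>The parameters appear in reverse order because \<open>norm_pair\<close> lists L before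
  P.\<close>

lemma norm_pair_model:
  "norm_pair (model_ucg s t :: ('k::field, 'k ^ 5) ucg) = (square_class t, square_class s)"
proof -
  have "proj_norm (model_form s t) (vec.span {axis i 1}) = square_class (model_form s t (axis i 1))"
    for i
    by (rule proj_norm_span[OF vec.vector_space_axioms quadratic_form_model])
       (simp add: axis_eq_0_iff)
  then show ?thesis
    unfolding norm_pair_def model_ucg_def ucg.simps by (simp add: model_form_def del: axis_5)
       (simp add: model_form_def)
qed

text \<open>If \<open>s = s' * a\<^sup>2\<close>, scaling the first coordinate by \<open>a\<close>
  and the second by its inverse absorbs the square factor, keeps the mixed term and fixes the line
  P. The other plane is treated likewise, so the map is even an isometry.\<close>

lemma model_isomorphic:
  fixes s t s' t' :: "'k::field"
  assumes "square_class s = square_class s'" and "square_class t = square_class t'"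
  shows "ucg_isomorphic (model_ucg s t) (model_ucg s' t')"
proof -
  obtain a b where a: "a \<noteq> 0" "s = s' * a\<^sup>2" and b: "b \<noteq> 0" "t = t' * b\<^sup>2"
    using assms[THEN square_class_eqD] by auto
  define f :: "'k ^ 5 \<Rightarrow> 'k ^ 5" where
    "f x = vector [a * x $ 1, x $ 2 / a, b * x $ 3, x $ 4 / b, x $ 5]" for x
  define g :: "'k ^ 5 \<Rightarrow> 'k ^ 5" where
    "g x = vector [x $ 1 / a, a * x $ 2, x $ 3 / b, b * x $ 4, x $ 5]" for x
  have lin: "Vector_Spaces.linear (*s) (*s) f"
    by (auto simp: Vector_Spaces.linear_iff vec.vector_space_axioms vec5_eq_iff f_def
        algebra_simps add_divide_distrib)
  have "g \<circ> f = id" "f \<circ> g = id"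
    using a(1) b(1) by (auto simp: fun_eq_iff f_def g_def vec5_eq_iff)
  then have "bij f" by (rule o_bij)
  moreover have "model_form s' t' (f x) = 1 * model_form s t x" for x
    using a b by (simp add: f_def model_form_def power_mult_distrib mult_ac)
  moreover have "vec.span {axis 1 1} = vec.span {f (axis 1 1)}"
    "vec.span {axis 3 1} = vec.span {f (axis 3 1)}"
  proof -
    have "f (axis 1 1) = a *s axis 1 1" "f (axis 3 1) = b *s axis 3 1"
      by (simp_all add: f_def vec5_eq_iff)
    then show "vec.span {axis 1 1} = vec.span {f (axis 1 1)}"
      "vec.span {axis 3 1} = vec.span {f (axis 3 1)}"
      using vec.span_image_scale[of "{axis 1 1 :: 'k ^ 5}" "\<lambda>_. a"] a(1)
        vec.span_image_scale[of "{axis 3 1 :: 'k ^ 5}" "\<lambda>_. b"] b(1) by (simp_all del: axis_5)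
  qed
  ultimately show ?thesis
    using lin
    by (intro ucg_isomorphicI[where f = f and c = 1 and u = "axis 1 1" and v = "axis 3 1"])
       (simp_all add: model_ucg_def del: axis_5)
qed

section \<open>Reduction of a non-degenerate geometry to a model\<close>

lemma linear_inj_bij_dim_eq:
  fixes f :: "'k::field ^ 'n \<Rightarrow> 'v::ab_group_add"
  assumes f: "Vector_Spaces.linear (*s) smul f" and "inj f"
    and dim: "vector_space.dim smul (UNIV :: 'v set) = CARD('n)"
  shows "bij f"
proof -
  interpret f: Vector_Spaces.linear "(*s)" smul f by fact
  obtain B where B: "f.vs2.independent B" "UNIV \<subseteq> f.vs2.span B" "card B = CARD('n)"
    using f.vs2.basis_exists[of UNIV] dim by metis
  \<comment> \<open>An infinite set has \<open>card\<close> 0, whereas \<open>CARD('n)\<close> is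
    positive.\<close>
  have "finite B" using B(3) card.infinite by fastforce
  then interpret B: finite_dimensional_vector_space smul B
    using B by unfold_locales auto
  interpret B: finite_dimensional_vector_space_pair "(*s)" cart_basis smul B ..
  have "f.vs2.dim (range f) = CARD('n)"
    using B.dim_image_eq[OF f, of UNIV] \<open>inj f\<close> by (simp add: vec_dim_card del: vec.dim_UNIV)
  then have "f.vs2.span (range f) = UNIV"
    by (simp add: B.dim_eq_full[symmetric] B.dimension_def B(3))
  then have "surj f"
    using f.span_image[of UNIV] by simp
  with \<open>inj f\<close> show ?thesis by (simp add: bij_def)
qed

text \<open>The coordinates of the model are realized by a basis \<open>vP\<close>,
  \<open>vl\<close>, \<open>vL\<close>, \<open>vp\<close>, \<open>w\<close>. That l and p are not
  ideal says exactly that B(P,l) and B(L,p) are non-zero; all other pairings among the first four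
  vectors vanish, apart from B(P,P) = 2 Q(P) and B(L,L) = 2 Q(L).\<close>

lemma nondegenerate_ucg_isomorphic_model:
  fixes G :: "('k::field, 'v::ab_group_add) ucg"
  assumes two: "(2::'k) \<noteq> 0" and nd: "nondegenerate_ucg 2 G"
  shows "\<exists>s t. ucg_isomorphic G (model_ucg s t)"
proof -
  define smul where "smul = ucg_scale G"
  define Q where "Q = ucg_form G"
  obtain p l where G: "universal_conformal_geometry 2 G"
    and p: "ucg_point G p" "\<not> ucg_hyperplane G p"
    and l: "ucg_hyperplane G l" "\<not> ucg_point G l" and pl: "proj_orthogonal Q p l"
    using nd unfolding nondegenerate_ucg_def ucg_ideal_def Q_def by blast
  have vs: "vector_space smul" and dim: "vector_space.dim smul (UNIV :: 'v set) = CARD(5)"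
    and qf: "quadratic_form smul Q" and nf: "nondegenerate_form Q"
    and PL: "proj_orthogonal Q (ucg_P G) (ucg_L G)"
    using G by (simp_all add: universal_conformal_geometry_def smul_def Q_def)
  interpret vector_space smul by fact
  note qfp = quadratic_form_polar[OF qf]
  obtain vP vL where vP: "ucg_P G = span {vP}" and vL: "ucg_L G = span {vL}"
    using G unfolding universal_conformal_geometry_def proj_points_def smul_def by blast
  obtain vp vl where vp: "p = span {vp}" and vl: "l = span {vl}"
    using p(1) l(1)
    unfolding ucg_point_def ucg_hyperplane_def ucg_hypercycle_def proj_points_def smul_def by blast
  have orth: "proj_orthogonal Q (span {u}) (span {v}) \<longleftrightarrow> polar Q u v = 0" for u v
    using proj_orthogonal_span[OF qf] unfolding proj_orthogonal_def by (meson singletonI span_base)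
  have B: "polar Q vP vL = 0" "polar Q vp vl = 0" "polar Q vP vp = 0" "polar Q vL vl = 0"
    "Q vp = 0" "Q vl = 0"
    and b: "polar Q vL vp \<noteq> 0" "polar Q vP vl \<noteq> 0"
    using PL pl p l unfolding ucg_point_def ucg_hyperplane_def ucg_hypercycle_def Q_def[symmetric]
    by (auto simp: vP vL vp vl orth span_base)
  have B': "polar Q vL vP = 0" "polar Q vl vp = 0" "polar Q vp vP = 0" "polar Q vl vL = 0"
    "polar Q vp vL = polar Q vL vp" "polar Q vl vP = polar Q vP vl"
    using B qfp(5) by metis+
  have "\<exists>v. v \<notin> span {vP, vl, vL, vp}"
  proof (rule ccontr)
    assume "\<nexists>v. v \<notin> span {vP, vl, vL, vp}"
    then have "dim UNIV \<le> card {vP, vl, vL, vp}"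
      by (intro dim_le_card) auto
    also have "\<dots> \<le> 4"
      using card_length[of "[vP, vl, vL, vp]"] by simp
    finally show False using dim by simp
  qed
  then obtain v where v: "v \<notin> span {vP, vl, vL, vp}" by blast
  \<comment> \<open>The vector \<open>v\<close> is projected to the orthogonal complement of the two
    planes. Only \<open>vP\<close> pairs non-trivially with \<open>vl\<close>, so \<open>a1\<close>
    is determined first; \<open>a2\<close> then corrects the pairing with \<open>vP\<close>,
    including the contribution of \<open>a1\<close>. The same goes for \<open>a3\<close> and
    \<open>a4\<close>.\<close>
  define a1 where "a1 = - polar Q v vl / polar Q vP vl"
  define a2 where "a2 = - (polar Q v vP + a1 * (2 * Q vP)) / polar Q vP vl"
  define a3 where "a3 = - polar Q v vp / polar Q vL vp"
  define a4 where "a4 = - (polar Q v vL + a3 * (2 * Q vL)) / polar Q vL vp"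
  define z where "z = smul a1 vP + smul a2 vl + smul a3 vL + smul a4 vp"
  define w where "w = v + z"
  have "z \<in> span {vP, vl, vL, vp}"
    unfolding z_def by (intro span_add span_scale span_base) auto
  then have "w \<noteq> 0"
    using v unfolding w_def by (metis add_eq_0_iff2 span_neg)
  have w: "polar Q w vP = 0" "polar Q w vl = 0" "polar Q w vL = 0" "polar Q w vp = 0"
  proof -
    have "polar Q w vl = polar Q v vl + a1 * polar Q vP vl"
      "polar Q w vp = polar Q v vp + a3 * polar Q vL vp"
      "polar Q w vP = polar Q v vP + a1 * (2 * Q vP) + a2 * polar Q vP vl"
      "polar Q w vL = polar Q v vL + a3 * (2 * Q vL) + a4 * polar Q vL vp"
      unfolding w_def z_def by (simp_all add: qfp(1,2,8) B B' add.assoc)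
    then show "polar Q w vP = 0" "polar Q w vl = 0" "polar Q w vL = 0" "polar Q w vp = 0"
      unfolding a2_def a4_def using b by (simp_all add: a1_def a3_def)
  qed
  then have w': "polar Q vP w = 0" "polar Q vl w = 0" "polar Q vL w = 0" "polar Q vp w = 0"
    using qfp(5) by metis+
  \<comment> \<open>The scalings \<alpha> and \<beta> stay free: \<open>F 1 1\<close> serves to show
    \<open>Q w \<noteq> 0\<close>, and only then can the final scalings, which contain
    \<open>Q w\<close>, be chosen.\<close>
  define F where "F \<alpha> \<beta> x = smul (x $ 1) vP + smul (\<alpha> * x $ 2) vl + smul (x $ 3) vL +
     smul (\<beta> * x $ 4) vp + smul (x $ 5) w" for \<alpha> \<beta> and x :: "'k ^ 5"
  have lin: "Vector_Spaces.linear (*s) smul (F \<alpha> \<beta>)" for \<alpha> \<beta>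
    by (auto simp: Vector_Spaces.linear_iff vec.vector_space_axioms vs F_def scale_left_distrib
        scale_right_distrib algebra_simps)
  have bij: "bij (F \<alpha> \<beta>)" if "\<alpha> \<noteq> 0" "\<beta> \<noteq> 0" for \<alpha> \<beta>
  proof (rule linear_inj_bij_dim_eq[OF lin _ dim])
    interpret F: Vector_Spaces.linear "(*s)" smul "F \<alpha> \<beta>" by (rule lin)
    have "x = 0" if x: "F \<alpha> \<beta> x = 0" for x
    proof -
      \<comment> \<open>Pairing with \<open>vl\<close>, \<open>vp\<close>, \<open>vP\<close>,
        \<open>vL\<close> isolates one coordinate after another; the last one is left as a multiple
        of \<open>w\<close>.\<close>
      have 0: "polar Q (F \<alpha> \<beta> x) u = 0" for u
        using qfp(2)[of 0 0 u] unfolding x by simp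
      have "x $ 1 = 0" using 0[of vl] b by (simp add: F_def qfp(1,2,8) B B' w w')
      moreover have "x $ 3 = 0" using 0[of vp] b by (simp add: F_def qfp(1,2,8) B B' w w')
      moreover have "x $ 2 = 0" using 0[of vP] b \<open>x $ 1 = 0\<close> \<open>\<alpha> \<noteq> 0\<close>
        by (simp add: F_def qfp(1,2,8) B B' w w')
      moreover have "x $ 4 = 0" using 0[of vL] b \<open>x $ 3 = 0\<close> \<open>\<beta> \<noteq> 0\<close>
        by (simp add: F_def qfp(1,2,8) B B' w w')
      ultimately show "x = 0"
        using x \<open>w \<noteq> 0\<close> by (simp add: F_def vec5_eq_iff)
    qed
    then show "inj (F \<alpha> \<beta>)" using F.inj_iff_eq_0 by blast
  qed
  define d where "d = Q w"
  \<comment> \<open>If \<open>w\<close> were isotropic, it would be orthogonal to all five basis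
    vectors, hence to the whole space.\<close>
  have "d \<noteq> 0"
  proof
    assume "d = 0"
    then have "polar Q w (F 1 1 x) = 0" for x
      by (simp add: F_def qfp(3,4,8) w d_def)
    then have "polar Q w u = 0" for u
      using bij[of 1 1] by (metis bij_pointE one_neq_zero)
    then show False
      using nf \<open>w \<noteq> 0\<close> unfolding nondegenerate_form_def by blast
  qed
  \<comment> \<open>Both hyperbolic pairings become \<open>d\<close>, the value of \<open>Q\<close>
    at \<open>w\<close>, so that \<open>d\<close> factors out of the whole form.\<close>
  define f where "f = F (d / polar Q vP vl) (d / polar Q vL vp)"
  have "Q (f x) = d * model_form (Q vP / d) (Q vL / d) x" for x
    using b \<open>d \<noteq> 0\<close>
    by (simp add: f_def F_def model_form_def qfp(1-4,6,7) B B' w w' d_def[symmetric]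
        distrib_left power2_eq_square)
  moreover have "f (axis 1 1) = vP" "f (axis 3 1) = vL"
    by (simp_all add: f_def F_def)
  ultimately have "ucg_isomorphic (model_ucg (Q vP / d) (Q vL / d)) G"
    using lin bij b \<open>d \<noteq> 0\<close> vP vL
    by (intro ucg_isomorphicI[where f = f and c = d and u = "axis 1 1" and v = "axis 3 1"])
       (simp_all add: model_ucg_def f_def Q_def smul_def del: axis_5)
  then show ?thesis
    using ucg_isomorphic_sym by blast
qed

section \<open>Square classes\<close>

text \<open>Everything is pulled back from the reals along \<phi>: a square has a non-negative
  image, and the preimage of the root of \<open>\<bar>\<phi> a\<bar>\<close> squares to
  \<open>a\<close> up to sign.\<close>

lemma real_field_squares:
  fixes \<phi> :: "'k::field \<Rightarrow> real"
  assumes "field_iso \<phi>"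
  shows "(2::'k) \<noteq> 0" and "\<nexists>x. (-1::'k) = x\<^sup>2" and "\<exists>c. a = c\<^sup>2 \<or> (a::'k) = -1 * c\<^sup>2"
proof -
  have \<phi>: "bij \<phi>" "\<phi> 1 = 1" "\<phi> (x + y) = \<phi> x + \<phi> y" "\<phi> (x * y) = \<phi> x * \<phi> y" for x y
    using assms by (auto simp: field_iso_def)
  have \<phi>0: "\<phi> 0 = 0"
    using \<phi>(3)[of 0 0] by simp
  have \<phi>m: "\<phi> (- x) = - \<phi> x" for x
    using \<phi>(3)[of x "- x"] \<phi>0 by simp
  have inj: "x = y" if "\<phi> x = \<phi> y" for x y
    using that \<phi>(1) by (simp add: bij_def inj_eq)
  have "\<phi> 2 = 2"
    using \<phi>(3)[of 1 1] \<phi>(2) by simp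
  then show "(2::'k) \<noteq> 0"
    using \<phi>0 by auto
  show "\<nexists>x. (-1::'k) = x\<^sup>2"
  proof
    assume "\<exists>x. (-1::'k) = x\<^sup>2"
    then obtain x where "(-1::'k) = x * x" by (auto simp: power2_eq_square)
    then have "-1 = \<phi> x * \<phi> x" using \<phi>(2,4) \<phi>m by metis
    then show False by (smt (verit) zero_le_square)
  qed
  obtain c where c: "\<phi> c = sqrt \<bar>\<phi> a\<bar>"
    using \<phi>(1) by (metis bij_pointE)
  then have "\<phi> (c\<^sup>2) = \<bar>\<phi> a\<bar>"
    by (simp add: power2_eq_square \<phi>(4))
  then have "\<phi> a = \<phi> (c\<^sup>2) \<or> \<phi> a = \<phi> (- (c\<^sup>2))"
    by (auto simp: \<phi>m)
  then show "\<exists>c. a = c\<^sup>2 \<or> a = -1 * c\<^sup>2"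
    using inj by auto
qed

text \<open>Translation by 1 permutes the field, so comparing the sums of all elements gives
  \<open>of_nat CARD('k) = 0\<close>. For an odd cardinality, \<open>2 = 0\<close> would turn this
  into \<open>1 = 0\<close>.\<close>

lemma finite_field_two_neq_0:
  assumes "finite (UNIV :: 'k::field set)" and "odd CARD('k)"
  shows "(2::'k) \<noteq> 0"
proof
  assume 2: "(2::'k) = 0"
  have "(\<Sum>x\<in>UNIV. x) = (\<Sum>x\<in>UNIV. x + 1 :: 'k)"
    by (rule sum.reindex_bij_witness[of _ "\<lambda>x. x + 1" "\<lambda>x. x - 1"]) auto
  then have "of_nat CARD('k) = (0::'k)"
    by (simp add: sum.distrib)
  moreover obtain m where "CARD('k) = 2 * m + 1"
    using assms(2) by (rule oddE)
  ultimately show False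
    using 2 by simp
qed

text \<open>The non-zero squares have index \<open>2\<close>, because squaring is two-to-one on the units.\<close>

lemma finite_field_squares:
  fixes e :: "'k::field"
  assumes fin: "finite (UNIV :: 'k set)" and two: "(2::'k) \<noteq> 0" and e: "\<nexists>x. e = x\<^sup>2"
  shows "\<exists>c. a = c\<^sup>2 \<or> a = e * c\<^sup>2"
proof -
  define U where "U = - {0::'k}"
  define S where "S = (\<lambda>x. x\<^sup>2) ` U"
  define T where "T = (*) e ` S"
  have finU: "finite U" using fin finite_subset[of U UNIV] by auto
  have "e \<noteq> 0" using e by (metis zero_power2)
  have fibre: "card {x \<in> U. x\<^sup>2 = y} = 2" if y: "y \<in> S" for y
  proof -
    obtain u where u: "u \<noteq> 0" "y = u\<^sup>2"
      using y by (auto simp: S_def U_def)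
    then have "{x \<in> U. x\<^sup>2 = y} = {u, - u}"
      by (auto simp: U_def power2_eq_iff)
    moreover have "u \<noteq> - u"
    proof
      assume "u = - u"
      then have "2 * u = 0" by (simp add: eq_neg_iff_add_eq_0)
      then show False using two u(1) by simp
    qed
    ultimately show ?thesis by simp
  qed
  have "card U = (\<Sum>y\<in>S. card {x \<in> U. x\<^sup>2 = y})"
    using sum.image_gen[OF finU, of "\<lambda>_. 1::nat" "\<lambda>x. x\<^sup>2"] by (simp add: S_def)
  then have cardU: "card U = 2 * card S"
    using fibre by simp
  have "inj_on ((*) e) S" using \<open>e \<noteq> 0\<close> by (auto simp: inj_on_def)
  then have "card T = card S" by (simp add: T_def card_image)
  \<comment> \<open>A common element would make \<open>e\<close> a quotient of squares. Being
    disjoint and each half as large as \<open>U\<close>, the squares and their multiples by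
    \<open>e\<close> exhaust \<open>U\<close>.\<close>
  moreover have "S \<inter> T = {}"
  proof (rule ccontr)
    assume "S \<inter> T \<noteq> {}"
    then obtain x y where "y \<noteq> 0" "x\<^sup>2 = e * y\<^sup>2" by (auto simp: S_def T_def U_def)
    then have "e = (x / y)\<^sup>2" by (simp add: power_divide)
    then show False using e by blast
  qed
  ultimately have "card (S \<union> T) = card U"
    using finU cardU by (subst card_Un_disjoint) (auto simp: S_def T_def)
  moreover have "S \<union> T \<subseteq> U" using \<open>e \<noteq> 0\<close> by (auto simp: S_def T_def U_def)
  ultimately have "S \<union> T = U" using finU by (simp add: card_subset_eq)
  moreover have "a = 0\<^sup>2 \<or> a \<in> U" by (auto simp: U_def)
  ultimately show ?thesis by (auto simp: S_def T_def)
qed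

lemma square_class_cases:
  fixes e :: "'k::field"
  assumes "\<And>a. \<exists>c. a = c\<^sup>2 \<or> a = e * c\<^sup>2"
  shows "square_class a \<in> square_class ` {0, 1, e}"
proof -
  obtain c where c: "a = c\<^sup>2 * 1 \<or> a = c\<^sup>2 * e"
    using assms[of a] by (auto simp: mult.commute)
  show ?thesis
  proof (cases "c = 0")
    case True
    with c show ?thesis by auto
  next
    case False
    with c show ?thesis using square_class_mult_square by blast
  qed
qed

text \<open>Elements of equal class differ by a non-zero square factor. This separates 0 from the
  rest, and \<open>e\<close> from 1 because \<open>e\<close> is not a square.\<close>

lemma inj_on_square_class:
  fixes e :: "'k::field"
  assumes e: "\<nexists>x. e = x\<^sup>2"
  shows "inj_on square_class {0, 1, e}"
proof -
  have "a = 0 \<longleftrightarrow> b = 0" if "square_class a = square_class b" for a b :: 'k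
    using square_class_eqD[OF that] by auto
  moreover have "square_class e \<noteq> square_class 1"
    using square_class_eqD[of e 1] e by auto
  ultimately show ?thesis
    unfolding inj_on_def using e by (metis insertE empty_iff)
qed

section \<open>The classification in dimension 2 and the count of classes\<close>

theorem mainTheorem3:
  fixes e :: "'k::field"
  assumes "((\<exists>\<phi> :: 'k \<Rightarrow> real. field_iso \<phi>) \<and> e = -1) \<or>
           (finite (UNIV :: 'k set) \<and> odd CARD('k) \<and> \<not> (\<exists>x. e = x ^ 2))"
  shows
    "(\<forall>G :: ('k, 'v::ab_group_add) ucg. nondegenerate_ucg 2 G \<longrightarrow>
        (\<exists>G' :: ('k, 'k ^ 5) ucg.
           nondegenerate_ucg 2 G' \<and> ucg_normalized G' \<and> ucg_isomorphic G G')) \<and>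
     (\<forall>(G :: ('k, 'v) ucg) (G' :: ('k, 'w::ab_group_add) ucg).
        nondegenerate_ucg 2 G \<and> ucg_normalized G \<and>
        nondegenerate_ucg 2 G' \<and> ucg_normalized G' \<longrightarrow>
        (ucg_isomorphic G G' \<longleftrightarrow> norm_pair G = norm_pair G')) \<and>
     (\<forall>G :: ('k, 'v) ucg. nondegenerate_ucg 2 G \<and> ucg_normalized G \<longrightarrow>
        norm_pair G \<in> {square_class 0, square_class 1, square_class e} \<times>
                      {square_class 0, square_class 1, square_class e}) \<and>
     (\<forall>s \<in> {0, 1, e}. \<forall>t \<in> {0, 1, e}.
        \<exists>G :: ('k, 'k ^ 5) ucg. nondegenerate_ucg 2 G \<and> ucg_normalized G \<and>
          norm_pair G = (square_class s, square_class t)) \<and>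
     (let A = {G :: ('k, 'k ^ 5) ucg. nondegenerate_ucg 2 G}
      in card (A // ucg_iso_rel A) = 9)"
proof -
  \<comment> \<open>These three facts are all that the two kinds of field have to supply; from here
    on they are treated alike.\<close>
  have "(2::'k) \<noteq> 0 \<and> (\<nexists>x. e = x\<^sup>2) \<and> (\<forall>a. \<exists>c. a = c\<^sup>2 \<or> a = e * c\<^sup>2)"
    using assms real_field_squares finite_field_two_neq_0 finite_field_squares by metis
  then have two: "(2::'k) \<noteq> 0" and e: "\<nexists>x. e = x\<^sup>2"
    and sq: "\<And>a. \<exists>c. a = c\<^sup>2 \<or> a = e * c\<^sup>2"
    by auto
  note model = nondegenerate_model[OF two] normalized_model[OF two]
  note ucg = nondegenerate_ucg_def[THEN iffD1, THEN conjunct1]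
  let ?E = "{0, 1, e}"
  have ex_model: "\<exists>s\<in>?E. \<exists>t\<in>?E. ucg_isomorphic H (model_ucg s t)"
    if H: "nondegenerate_ucg 2 H" for H :: "('k, 'u::ab_group_add) ucg"
  proof -
    obtain s t where st: "ucg_isomorphic H (model_ucg s t)"
      using nondegenerate_ucg_isomorphic_model[OF two H] by blast
    obtain s' t' where "s' \<in> ?E" "square_class s = square_class s'"
      "t' \<in> ?E" "square_class t = square_class t'"
      using square_class_cases[OF sq, of s] square_class_cases[OF sq, of t] by blast
    then show ?thesis
      using ucg_isomorphic_trans[OF st model_isomorphic] by blast
  qed
  have inv: "norm_pair H = norm_pair H'"
    if "nondegenerate_ucg 2 H" "ucg_normalized H" "nondegenerate_ucg 2 H'" "ucg_normalized H'"
      "ucg_isomorphic H H'"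
    for H :: "('k, 'u::ab_group_add) ucg" and H' :: "('k, 'u'::ab_group_add) ucg"
    using norm_pair_eq_if_isomorphic[OF two ucg that(2) ucg that(4,5)] that(1,3) by blast
  have iso: "ucg_isomorphic H H'"
    if H: "nondegenerate_ucg 2 H" "ucg_normalized H"
      and H': "nondegenerate_ucg 2 H'" "ucg_normalized H'"
      and eq: "norm_pair H = norm_pair H'"
    for H :: "('k, 'u::ab_group_add) ucg" and H' :: "('k, 'u'::ab_group_add) ucg"
  proof -
    obtain s t s' t' where st: "ucg_isomorphic H (model_ucg s t)"
      and st': "ucg_isomorphic H' (model_ucg s' t')"
      using nondegenerate_ucg_isomorphic_model[OF two] H(1) H'(1) by meson
    \<comment> \<open>Models are normalized, so each geometry has the same norms as its model;
      equality of norms thus passes to the models, where it can be turned into an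
      isomorphism.\<close>
    have "norm_pair (model_ucg s t) = norm_pair (model_ucg s' t')"
      using inv[OF H model st] inv[OF H' model st'] eq by simp
    then have st_st': "ucg_isomorphic (model_ucg s t) (model_ucg s' t')"
      by (intro model_isomorphic) (simp_all add: norm_pair_model)
    show ?thesis
      by (rule ucg_isomorphic_trans[OF ucg_isomorphic_trans[OF st st_st'] ucg_isomorphic_sym[OF st']])
  qed
  have norms: "norm_pair H \<in> square_class ` ?E \<times> square_class ` ?E"
    if H: "nondegenerate_ucg 2 H" "ucg_normalized H" for H :: "('k, 'u::ab_group_add) ucg"
  proof -
    obtain s t where "ucg_isomorphic H (model_ucg s t)"
      using nondegenerate_ucg_isomorphic_model[OF two H(1)] by blast
    then have "norm_pair H = (square_class t, square_class s)"
      using inv[OF H model] by (simp add: norm_pair_model)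
    then show ?thesis
      using square_class_cases[OF sq, of s] square_class_cases[OF sq, of t]
      by (simp only: mem_Times_iff fst_conv snd_conv)
  qed
  define A where "A = {G :: ('k, 'k ^ 5) ucg. nondegenerate_ucg 2 G}"
  define R where "R = ucg_iso_rel A"
  have R: "equiv A R"
    unfolding R_def by (rule equiv_ucg_iso_rel)
      (auto simp: A_def nondegenerate_ucg_def universal_conformal_geometry_def)
  have mA: "model_ucg s t \<in> A" for s t
    using model by (simp add: A_def)
  \<comment> \<open>The nine models represent the classes. They are pairwise non-isomorphic by the
    invariance of norms, and every class contains one of them by \<open>ex_model\<close>, also if
    its other members are not normalized.\<close>
  have "bij_betw (\<lambda>(s, t). R `` {model_ucg s t}) (?E \<times> ?E) (A // R)"
    unfolding bij_betw_def
  proof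
    show "inj_on (\<lambda>(s, t). R `` {model_ucg s t}) (?E \<times> ?E)"
    proof (rule inj_onI, clarify)
      fix s t s' t' assume st: "s \<in> ?E" "t \<in> ?E" "s' \<in> ?E" "t' \<in> ?E"
        and "R `` {model_ucg s t} = R `` {model_ucg s' t'}"
      then have "(model_ucg s t, model_ucg s' t') \<in> R"
        using R mA eq_equiv_class by metis
      then have "ucg_isomorphic (model_ucg s t) (model_ucg s' t')"
        by (simp add: R_def ucg_iso_rel_def)
      then have "square_class s = square_class s'" "square_class t = square_class t'"
        using inv[OF model model] by (simp_all add: norm_pair_model)
      then show "s = s' \<and> t = t'"
        using inj_onD[OF inj_on_square_class[OF e]] st by blast
    qed
    show "(\<lambda>(s, t). R `` {model_ucg s t}) ` (?E \<times> ?E) = A // R"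
    proof
      show "(\<lambda>(s, t). R `` {model_ucg s t}) ` (?E \<times> ?E) \<subseteq> A // R"
        using mA by (auto intro: quotientI)
      show "A // R \<subseteq> (\<lambda>(s, t). R `` {model_ucg s t}) ` (?E \<times> ?E)"
      proof
        fix X assume "X \<in> A // R"
        then obtain H where H: "H \<in> A" "X = R `` {H}" by (rule quotientE)
        then obtain s t where st: "s \<in> ?E" "t \<in> ?E" "ucg_isomorphic H (model_ucg s t)"
          using ex_model unfolding A_def by blast
        then have "(H, model_ucg s t) \<in> R"
          using H(1) mA by (simp add: R_def ucg_iso_rel_def)
        then have "X = R `` {model_ucg s t}"
          using H(2) R equiv_class_eq by metis
        with st(1,2) show "X \<in> (\<lambda>(s, t). R `` {model_ucg s t}) ` (?E \<times> ?E)"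
          by (auto intro!: rev_image_eqI[of "(s, t)"])
      qed
    qed
  qed
  then have "card (A // R) = card (?E \<times> ?E)"
    by (simp add: bij_betw_same_card)
  \<comment> \<open>Both 0 and 1 are squares, so \<open>e\<close> differs from them.\<close>
  moreover have "card ?E = 3"
    using e by (auto simp: card_insert_if) (metis power_one zero_power2)+
  ultimately have card: "card (A // R) = 9"
    by (simp only: card_cartesian_product)
  show ?thesis
    unfolding Let_def
  proof (intro conjI allI impI ballI)
    fix G :: "('k, 'v) ucg" assume "nondegenerate_ucg 2 G"
    then show "\<exists>G' :: ('k, 'k ^ 5) ucg.
        nondegenerate_ucg 2 G' \<and> ucg_normalized G' \<and> ucg_isomorphic G G'"
      using ex_model model by blast
  next
    fix G :: "('k, 'v) ucg" and G' :: "('k, 'w) ucg"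
    assume "nondegenerate_ucg 2 G \<and> ucg_normalized G \<and> nondegenerate_ucg 2 G' \<and> ucg_normalized G'"
    then show "ucg_isomorphic G G' \<longleftrightarrow> norm_pair G = norm_pair G'"
      using inv iso by blast
  next
    fix G :: "('k, 'v) ucg" assume "nondegenerate_ucg 2 G \<and> ucg_normalized G"
    then have "norm_pair G \<in> square_class ` ?E \<times> square_class ` ?E"
      using norms by blast
    then show "norm_pair G \<in> {square_class 0, square_class 1, square_class e} \<times>
                             {square_class 0, square_class 1, square_class e}"
      by (simp only: image_insert image_empty)
  next
    fix s t
    show "\<exists>G :: ('k, 'k ^ 5) ucg. nondegenerate_ucg 2 G \<and> ucg_normalized G \<and>
            norm_pair G = (square_class s, square_class t)"
      \<comment> \<open>The witness is \<open>model_ucg t s\<close>, with the parameters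
        exchanged.\<close>
      using model norm_pair_model by blast
  next
    show "card ({G :: ('k, 'k ^ 5) ucg. nondegenerate_ucg 2 G} //
        ucg_iso_rel {G. nondegenerate_ucg 2 G}) = 9"
      using card by (simp add: A_def R_def)
  qed
qed

end
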